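(* Let $W\subset V\otimes\mathbb{R}^\ell$ be a geometric non-local space, let $\alpha=-\kappa'(1)/\log m$, where $\alpha\in(0,1)$, and let $\varphi\colon W\to V$ be a canceling linear operator. There exist constants $1\ll C_1\ll C_2\ll C_3$ such that the function $$\Phi(x,y,z,t,s)=|y|t+C_1|x|t+C_2|x|\sqrt{st}+C_3(z-|x|)s$$ on $\Omega$ is a supersolution. Here $1\ll C_1\ll C_2\ll C_3$ means that the assertion holds whenever $C_1$ is sufficiently large, $C_2$ is sufficiently large depending on $C_1$, and $C_3$ is sufficiently large depending on $C_1,C_2$.
   Context: Fix integers $m\geq 2$, $\ell\geq 1$. $\mathbb{R}_+=[0,\infty)$. $V=\{v\in\mathbb{R}^m:\sum_j v_j=0\}$; $V\otimes\mathbb{R}^\ell$ is identified with $\{(w_1,\dots,w_m)\in(\mathbb{R}^\ell)^m:\sum_j w_j=0\}$, and $v\otimes a=(v_1a,\dots,v_ma)$. $W\subset V\otimes\mathbb{R}^\ell$ is a linear subspace. Let $\mathbb{M}^W=\{v\in V: v_j\ge-1\ \forall j,\ \exists a\in\mathbb{R}^\ell\setminus\{0\}\text{ with }v\otimes a\in W\}$. For $v\in V$ put $\kappa_v(\theta)=\theta\log\big(\frac1m\sum_{j=1}^m|1+v_j|^{1/\theta}\big)$ for $\theta\in(0,1]$ and $\kappa_v(0)=\log\max_j|1+v_j|$; put $\kappa(\theta)=\sup_{v\in\mathbb{M}^W}\kappa_v(\theta)$, $\theta\in[0,1]$; $\kappa'(1)$ is the left derivative. $W$ is geometric if $\kappa$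 is affine on $[0,1]$. For a geometric $W$ with $\alpha=-\kappa'(1)/\log m$, a vector $v\otimes a\in W$ with $v\in\mathbb{M}^W$, $a\neq0$ is extremal if $\frac1m\sum_j(1+v_j)\log(1+v_j)=\alpha\log m$ (with $0\log0=0$); its support is $H=\{j:1+v_j\ne0\}$. (Then $1+v_j=m^\alpha$ for $j\in H$.) $\varphi$ is canceling if $(\varphi[v\otimes a])_j=0$ for every $j\in H$, for every extremal $v\otimes a$ with support $H$. $W$ is non-local (of order $\alpha$) if for every extremal vector $v\otimes a$ with support $H$, every $w\in W$ and every $b\in\mathbb{R}^\ell$, the condition $b+w_j=0$ for all $j\notin H$ implies that $w$ is proportional to $v\otimes a$. Let $\Omega=\{(x,y,z,t,s)\in\mathbb{R}^\ell\times\mathbb{R}\times\mathbb{R}_+^3:\ |x|\le z,\ t\le s\}$. The configuration space $\mathfrak{W}$ consists of strings $(\{x_j\}_{j=1}^m,y,\{z_j\}_{j=1}^m,\{t_j\}_{j=1}^m,\{s_j\}_{j=1}^m)$ with $x_j\in\mathbb{R}^\ell$, $y\in\mathbb{R}$, $z_j,t_j,s_j\in\mathbb{R}_+$, $|x_j|\le z_j$, $t_j\le s_j$ such that, with $$x=\tfrac1m\sum_j x_j,\quad z=\tfrac1m\sum_j z_j,\quad t=\sum_j t_j,\quad s=\max\big(t,\,m^{1-\alpha}\max_j s_j\big),\quad \vec{x}=(x_1-x,\dots,x_m-x),$$ one has $\vec{x}\in W$. A function $G\colon\Omega\to\mathbb{R}$ satisfies the main inequality if for every element of $\mathfrak{W}$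 (and the corresponding $x,z,t,s,\vec{x}$) $$G(x,y,z,t,s)\ \ge\ m^{-\alpha}\sum_{j=1}^m G\big(x_j,\ m^\alpha y+(\varphi[\vec{x}])_j,\ z_j,\ t_j,\ s_j\big).$$ $G$ is a supersolution if it satisfies the main inequality and the boundary inequality $G(x,y,|x|,t,s)\ge|y|t$ for all $x\in\mathbb{R}^\ell,\ y\in\mathbb{R},\ 0\le t\le s$. *)

theory Defs
  imports "HOL-Analysis.Analysis"
begin

text \<open>
  The index set \<open>{1,...,m}\<close> is the finite type \<open>'m\<close>, and \<open>\<real>\<^sup>\<ell>\<close> is \<open>real ^ 'l\<close>.
  An element \<open>(w_1,...,w_m)\<close> of \<open>(\<real>\<^sup>\<ell>)\<^sup>m\<close> is a value of type \<open>real ^ 'l ^ 'm\<close>.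
\<close>

definition V :: "(real ^ 'm) set" where
  "V = {v. (\<Sum>j\<in>UNIV. v $ j) = 0}"

definition V_tensor :: "(real ^ 'l ^ 'm) set" where
  "V_tensor = {w. (\<Sum>j\<in>UNIV. w $ j) = 0}"

definition tensor :: "real ^ 'm \<Rightarrow> real ^ 'l \<Rightarrow> real ^ 'l ^ 'm"  (infixl "\<otimes>\<^sub>v" 75) where
  "v \<otimes>\<^sub>v a = (\<chi> j. v $ j *\<^sub>R a)"

definition MW :: "(real ^ 'l ^ 'm) set \<Rightarrow> (real ^ 'm) set" where
  "MW W = {v \<in> V. (\<forall>j. v $ j \<ge> -1) \<and> (\<exists>a. a \<noteq> 0 \<and> v \<otimes>\<^sub>v a \<in> W)}"

definition kappa_at :: "real ^ 'm \<Rightarrow> real \<Rightarrow> real" where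
  "kappa_at v \<theta> =
     (if \<theta> = 0 then ln (MAX j. \<bar>1 + v $ j\<bar>)
      else \<theta> * ln (1 / real CARD('m) * (\<Sum>j\<in>UNIV. \<bar>1 + v $ j\<bar> powr (1 / \<theta>))))"

text \<open>
  The supremum is over a nonempty set (it contains \<open>v = 0\<close>) of values which, for
  \<open>\<theta> \<in> [0,1]\<close>, is bounded above since \<open>MW W\<close> is bounded.
\<close>
definition kappa :: "(real ^ 'l ^ 'm) set \<Rightarrow> real \<Rightarrow> real" where
  "kappa W \<theta> = (SUP v\<in>MW W. kappa_at v \<theta>)"

definition geometric :: "(real ^ 'l ^ 'm) set \<Rightarrow> bool" where
  "geometric W \<longleftrightarrow> (\<exists>c d. \<forall>\<theta>\<in>{0..1}. kappa W \<theta> = c * \<theta> + d)"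

definition order_alpha :: "(real ^ 'l ^ 'm) set \<Rightarrow> real" where
  "order_alpha W = - vector_derivative (kappa W) (at_left 1) / ln (real CARD('m))"

text \<open>
  Extremality and support are properties of the pair \<open>(v, a)\<close> representing the vector
  \<open>v \<otimes>\<^sub>v a\<close>. The convention \<open>0 log 0 = 0\<close> holds automatically.
\<close>
definition extremal :: "(real ^ 'l ^ 'm) set \<Rightarrow> real ^ 'm \<Rightarrow> real ^ 'l \<Rightarrow> bool" where
  "extremal W v a \<longleftrightarrow> v \<in> MW W \<and> a \<noteq> 0 \<and> v \<otimes>\<^sub>v a \<in> W \<and>
     1 / real CARD('m) * (\<Sum>j\<in>UNIV. (1 + v $ j) * ln (1 + v $ j))
       = order_alpha W * ln (real CARD('m))"

definition supp :: "real ^ 'm \<Rightarrow> 'm set" where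
  "supp v = {j. 1 + v $ j \<noteq> 0}"

text \<open>Linear operators \<open>W \<rightarrow> V\<close>; the values of \<open>\<phi>\<close> outside \<open>W\<close> are irrelevant.\<close>
definition linear_operator :: "(real ^ 'l ^ 'm) set \<Rightarrow> (real ^ 'l ^ 'm \<Rightarrow> real ^ 'm) \<Rightarrow> bool" where
  "linear_operator W \<phi> \<longleftrightarrow> \<phi> \<in> W \<rightarrow> V \<and>
     (\<forall>u\<in>W. \<forall>w\<in>W. \<phi> (u + w) = \<phi> u + \<phi> w) \<and>
     (\<forall>c. \<forall>w\<in>W. \<phi> (c *\<^sub>R w) = c *\<^sub>R \<phi> w)"

definition canceling :: "(real ^ 'l ^ 'm) set \<Rightarrow> (real ^ 'l ^ 'm \<Rightarrow> real ^ 'm) \<Rightarrow> bool" where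
  "canceling W \<phi> \<longleftrightarrow> (\<forall>v a. extremal W v a \<longrightarrow> (\<forall>j\<in>supp v. \<phi> (v \<otimes>\<^sub>v a) $ j = 0))"

definition nonlocal :: "(real ^ 'l ^ 'm) set \<Rightarrow> bool" where
  "nonlocal W \<longleftrightarrow> (\<forall>v a. extremal W v a \<longrightarrow>
     (\<forall>w\<in>W. \<forall>b. (\<forall>j. j \<notin> supp v \<longrightarrow> b + w $ j = 0) \<longrightarrow> (\<exists>c. w = c *\<^sub>R (v \<otimes>\<^sub>v a))))"

definition Omega :: "((real ^ 'l) \<times> real \<times> real \<times> real \<times> real) set" where
  "Omega = {(x, y, z, t, s). 0 \<le> z \<and> 0 \<le> t \<and> 0 \<le> s \<and> norm x \<le> z \<and> t \<le> s}"

definition avg :: "'a::real_vector ^ 'm \<Rightarrow> 'a" where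
  "avg x = (1 / real CARD('m)) *\<^sub>R (\<Sum>j\<in>UNIV. x $ j)"

definition tot :: "real ^ 'm \<Rightarrow> real" where
  "tot t = (\<Sum>j\<in>UNIV. t $ j)"

definition smax :: "real \<Rightarrow> real ^ 'm \<Rightarrow> real ^ 'm \<Rightarrow> real" where
  "smax \<alpha> t s = max (tot t) (real CARD('m) powr (1 - \<alpha>) * (MAX j. s $ j))"

definition centered :: "real ^ 'l ^ 'm \<Rightarrow> real ^ 'l ^ 'm" where
  "centered x = (\<chi> j. x $ j - avg x)"

definition config_space ::
  "(real ^ 'l ^ 'm) set \<Rightarrow> ((real ^ 'l ^ 'm) \<times> real \<times> (real ^ 'm) \<times> (real ^ 'm) \<times> (real ^ 'm)) set" where
  "config_space W = {(x, y, z, t, s).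
     (\<forall>j. (x $ j, y, z $ j, t $ j, s $ j) \<in> Omega) \<and> centered x \<in> W}"

text \<open>
  Functions on \<open>Omega\<close> are represented by total functions. Only their values on \<open>Omega\<close>
  matter below: see \<open>config_in_Omega\<close> and \<open>config_avg_in_Omega\<close>.
\<close>
definition main_inequality ::
  "(real ^ 'l ^ 'm) set \<Rightarrow> (real ^ 'l ^ 'm \<Rightarrow> real ^ 'm) \<Rightarrow>
   ((real ^ 'l) \<times> real \<times> real \<times> real \<times> real \<Rightarrow> real) \<Rightarrow> bool" where
  "main_inequality W \<phi> G \<longleftrightarrow> (\<forall>(x, y, z, t, s) \<in> config_space W.
     G (avg x, y, avg z, tot t, smax (order_alpha W) t s)
       \<ge> real CARD('m) powr (- order_alpha W) *
         (\<Sum>j\<in>UNIV. G (x $ j, real CARD('m) powr order_alpha W * y + \<phi> (centered x) $ j,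
                          z $ j, t $ j, s $ j)))"

definition boundary_inequality :: "((real ^ 'l) \<times> real \<times> real \<times> real \<times> real \<Rightarrow> real) \<Rightarrow> bool" where
  "boundary_inequality G \<longleftrightarrow>
     (\<forall>x y t s. 0 \<le> t \<and> t \<le> s \<longrightarrow> G (x, y, norm x, t, s) \<ge> \<bar>y\<bar> * t)"

definition supersolution ::
  "(real ^ 'l ^ 'm) set \<Rightarrow> (real ^ 'l ^ 'm \<Rightarrow> real ^ 'm) \<Rightarrow>
   ((real ^ 'l) \<times> real \<times> real \<times> real \<times> real \<Rightarrow> real) \<Rightarrow> bool" where
  "supersolution W \<phi> G \<longleftrightarrow> main_inequality W \<phi> G \<and> boundary_inequality G"

definition Phi ::
  "real \<Rightarrow> real \<Rightarrow> real \<Rightarrow> (real ^ 'l) \<times> real \<times> real \<times> real \<times> real \<Rightarrow> real" where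
  "Phi C1 C2 C3 = (\<lambda>(x, y, z, t, s).
     \<bar>y\<bar> * t + C1 * norm x * t + C2 * norm x * sqrt (s * t) + C3 * (z - norm x) * s)"

lemma config_in_Omega:
  "(x, y, z, t, s) \<in> config_space W \<Longrightarrow> (x $ j, y', z $ j, t $ j, s $ j) \<in> Omega"
  by (auto simp: config_space_def Omega_def)

lemma config_avg_in_Omega:
  assumes "(x, y, z, t, s) \<in> config_space W"
  shows "(avg x, y, avg z, tot t, smax \<alpha> t s) \<in> Omega"
proof -
  have *: "norm (x $ j) \<le> z $ j" "0 \<le> z $ j" "0 \<le> t $ j" for j
    using assms by (auto simp: config_space_def Omega_def)
  have "norm (\<Sum>j\<in>UNIV. x $ j) \<le> (\<Sum>j\<in>UNIV. z $ j)"
    by (rule sum_norm_le) (use * in auto)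
  then have "norm (avg x) \<le> avg z"
    by (simp add: avg_def divide_right_mono)
  moreover have "0 \<le> avg z" using * by (simp add: avg_def sum_nonneg)
  moreover have "0 \<le> tot t" using * by (simp add: tot_def sum_nonneg)
  ultimately show ?thesis by (simp add: Omega_def smax_def)
qed

end

theory Submission
  imports Defs
begin

text \<open>
  Write \<open>m = CARD('m)\<close>, \<open>A = m powr \<alpha>\<close>, \<open>x\<close> for the tuple \<open>(x\<^sub>j)\<close> and \<open>\<psi> x = \<phi> (centered x)\<close>.
  Each of the four summands of \<open>Phi\<close> contributes one difference to the main inequality.
  The first one is at least \<open>-(\<Sum>j. \<bar>\<psi>\<^sub>j x\<bar> t\<^sub>j)\<close>, which removes \<open>y\<close>, and this loss has to be paid for by the
  others. The second one equals \<open>C1 (\<Sum>j. F\<^sub>j t\<^sub>j)\<close> with \<open>F\<^sub>j = \<bar>avg x\<bar> - \<bar>x\<^sub>j\<bar> / A\<close>. By the Cauchy-Schwarz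
  inequality the third one is at least \<open>C2 G \<surd>(s t)\<close> with \<open>G = \<bar>avg x\<bar> - \<bar>x\<bar> / \<surd>(A m)\<close>. The fourth one is at
  least \<open>C3 D s\<close>, where \<open>D\<close>, the average of the \<open>\<bar>x\<^sub>j\<bar>\<close> minus \<open>\<bar>avg x\<bar>\<close>, is nonnegative and measures
  how far the \<open>x\<^sub>j\<close> are from being aligned. Since \<open>t \<le> \<surd>(s t) \<le> s\<close>, everything reduces to an
  estimate on the tuple alone: there is \<open>M > 0\<close> such that, on the space \<open>X\<close> of tuples with
  \<open>centered x \<in> W\<close>,

  \<open>0 \<le> G + M D\<close> and \<open>\<bar>\<psi>\<^sub>j x\<bar> \<le> M (F\<^sub>j + M (G + M D))\<close> for all \<open>j\<close>.

  Then \<open>C1 \<ge> M\<close>, \<open>C2 \<ge> C1 M\<close> and \<open>C3 \<ge> C2 M\<close> suffice (\<open>main_inequality_if_core_estimate\<close>).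

  The estimate is positively homogeneous in \<open>x\<close> and becomes weaker as \<open>M\<close> grows, so by compactness
  of the unit sphere of \<open>X\<close> it is enough to prove it near each nonzero \<open>x0 \<in> X\<close>, with \<open>M\<close> depending on
  \<open>x0\<close>. If \<open>D > 0\<close> or \<open>G > 0\<close> at \<open>x0\<close>, a large \<open>M\<close> gives strict inequalities at \<open>x0\<close>, and these persist
  nearby. Suppose \<open>D = 0\<close>. Then \<open>x0\<^sub>j = (1 + v\<^sub>j) avg x0\<close> with \<open>v \<in> MW W\<close>, and geometricity gives
  \<open>0 \<le> 1 + v\<^sub>j \<le> A\<close>, whence \<open>G \<ge> 0\<close>, with equality only if every \<open>1 + v\<^sub>j\<close> is \<open>0\<close> or \<open>A\<close>, that is, only if
  \<open>v \<otimes> avg x0\<close> is extremal.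

  Near an extremal \<open>x0\<close> with support \<open>H\<close> both assumptions on \<open>W\<close> and \<open>\<phi>\<close> enter. Nonlocality says that
  the components \<open>x\<^sub>j\<close>, \<open>j \<notin> H\<close>, determine \<open>x\<close> modulo \<open>x0\<close>; by linearity the distance from \<open>x\<close> to the
  line through \<open>x0\<close> is \<open>O(\<epsilon>)\<close>, \<open>\<epsilon> = (\<Sum>j\<notin>H. \<bar>x\<^sub>j\<bar>)\<close>. For \<open>j \<in> H\<close>, canceling makes \<open>\<psi>\<^sub>j\<close> vanish at \<open>x0\<close>, so both
  \<open>\<psi>\<^sub>j\<close> and the negative part of \<open>F\<^sub>j\<close> are \<open>O(\<epsilon>)\<close>. The decisive point (\<open>expansion_near_extremal\<close>) is that
  \<open>G + 2 D\<close> grows at least like \<open>\<epsilon>\<close>: the components outside \<open>H\<close> increase \<open>G\<close> if they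
  point along \<open>avg x0\<close>, and increase \<open>D\<close> if they do not. For \<open>j \<notin> H\<close>, \<open>F\<^sub>j\<close> is close to
  \<open>\<bar>avg x0\<bar> > 0\<close> and controls \<open>\<psi>\<^sub>j\<close> on its own.
\<close>

section \<open>Geometric spaces\<close>

text \<open>
  All \<open>kappa_at v\<close> vanish at \<open>1\<close>, so the affine function \<open>kappa W\<close> with slope \<open>-\<alpha> ln m\<close>
  takes the value \<open>\<alpha> ln m\<close> at \<open>0\<close>; there it dominates \<open>kappa_at v 0\<close>, the logarithm of the largest
  \<open>\<bar>1 + v\<^sub>j\<bar>\<close>.
\<close>
lemma geometric_MW_bound:
  fixes W :: "(real ^ 'l ^ 'm) set"
  assumes m: "CARD('m) \<ge> 2" and geo: "geometric W" and v: "v \<in> MW W"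
  shows "1 + v $ j \<le> real CARD('m) powr order_alpha W"
proof -
  let ?m = "real CARD('m)"
  have m1: "?m > 1" using m by simp
  have sum1: "(\<Sum>j\<in>UNIV. 1 + u $ j) = ?m" if "u \<in> MW W" for u
    using that by (simp add: MW_def V_def sum.distrib)
  have nn: "0 \<le> 1 + u $ j" if "u \<in> MW W" for u j
    using that by (simp add: MW_def) (smt (verit))
  have le_m: "1 + u $ j \<le> ?m" if "u \<in> MW W" for u j
    using member_le_sum[of j UNIV "\<lambda>j. 1 + u $ j"] nn[OF that] sum1[OF that] by simp
  have one_le: "1 \<le> (MAX j. \<bar>1 + u $ j\<bar>)" if "u \<in> MW W" for u
  proof (rule ccontr)
    assume "\<not> ?thesis"
    then have "1 + u $ j < 1" for j
      using Max_ge[of "range (\<lambda>j. \<bar>1 + u $ j\<bar>)" "\<bar>1 + u $ j\<bar>"]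
      by (smt (verit) finite finite_imageI rangeI)
    then have "(\<Sum>j\<in>UNIV. 1 + u $ j) < (\<Sum>j\<in>(UNIV::'m set). 1)"
      by (intro sum_strict_mono) auto
    then show False using sum1[OF that] by simp
  qed
  have max_le: "(MAX j. \<bar>1 + u $ j\<bar>) \<le> ?m" if "u \<in> MW W" for u
    using nn[OF that] le_m[OF that] by (subst Max_le_iff) auto
  have k1: "kappa_at u 1 = 0" if "u \<in> MW W" for u
  proof -
    have "(\<Sum>j\<in>UNIV. \<bar>1 + u $ j\<bar> powr (1 / 1)) = ?m"
      unfolding sum1[OF that, symmetric]
      by (rule sum.cong) (use nn[OF that] in auto)
    then show ?thesis by (simp add: kappa_at_def)
  qed
  have kappa1: "kappa W 1 = 0"
  proof -
    have "(\<lambda>u. kappa_at u 1) ` MW W = {0}"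
      using v k1 by auto
    then show ?thesis by (simp add: kappa_def)
  qed
  have "bdd_above ((\<lambda>u. kappa_at u 0) ` MW W)"
  proof (rule bdd_aboveI2)
    fix u assume "u \<in> MW W"
    from one_le[OF this] max_le[OF this] show "kappa_at u 0 \<le> ln ?m"
      by (simp add: kappa_at_def)
  qed
  \<comment> \<open>without this bound the supremum over \<open>MW W\<close> could be an unspecified value\<close>
  then have k0: "kappa_at v 0 \<le> kappa W 0"
    unfolding kappa_def using v by (intro cSUP_upper)
  obtain c d where cd: "\<And>\<theta>. \<theta> \<in> {0..1} \<Longrightarrow> kappa W \<theta> = c * \<theta> + d"
    using geo unfolding geometric_def by blast
  have "((\<lambda>\<theta>. c * \<theta> + d) has_vector_derivative c) (at 1 within {0..1})"
    by (auto intro!: derivative_eq_intros)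
  then have "(kappa W has_vector_derivative c) (at 1 within {0..1})"
    by (rule has_vector_derivative_transform[rotated 2]) (auto simp: cd)
  then have "vector_derivative (kappa W) (at_left 1) = c"
    by (simp add: at_within_Icc_at_left vector_derivative_within)
  then have alpha: "order_alpha W * ln ?m = - c"
    using m1 by (simp add: order_alpha_def)
  have "ln (MAX j. \<bar>1 + v $ j\<bar>) \<le> order_alpha W * ln ?m"
    using k0 kappa1 cd[of 0] cd[of 1] alpha by (simp add: kappa_at_def)
  then have "(MAX j. \<bar>1 + v $ j\<bar>) \<le> exp (order_alpha W * ln ?m)"
    using one_le[OF v] by (metis exp_le_cancel_iff exp_ln less_le_trans zero_less_one)
  also have "\<dots> = ?m powr order_alpha W" using m1 by (simp add: powr_def)
  finally show ?thesis
    using Max_ge[of "range (\<lambda>j. \<bar>1 + v $ j\<bar>)" "\<bar>1 + v $ j\<bar>"]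
    by (smt (verit) finite finite_imageI rangeI)
qed

lemma extremal_if_two_valued:
  fixes W :: "(real ^ 'l ^ 'm) set"
  assumes "CARD('m) \<ge> 2" "v \<in> MW W" "a \<noteq> 0" "v \<otimes>\<^sub>v a \<in> W"
    and two: "\<And>j. 1 + v $ j = 0 \<or> 1 + v $ j = real CARD('m) powr order_alpha W"
  shows "extremal W v a"
proof -
  let ?m = "real CARD('m)"
  have "(1 + v $ j) * ln (1 + v $ j) = (1 + v $ j) * (order_alpha W * ln ?m)" for j
    using two[of j] assms(1) by (auto simp: ln_powr)
  then have "(\<Sum>j\<in>UNIV. (1 + v $ j) * ln (1 + v $ j)) = (\<Sum>j\<in>UNIV. 1 + v $ j) * (order_alpha W * ln ?m)"
    unfolding sum_distrib_right by (intro sum.cong) simp_all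
  also have "(\<Sum>j\<in>UNIV. 1 + v $ j) = ?m"
    using assms(2) by (simp add: MW_def V_def sum.distrib)
  finally show ?thesis using assms by (simp add: extremal_def)
qed

section \<open>Alignment defect and spread gap\<close>

text \<open>The fourth summand of \<open>Phi\<close> yields this quantity; it vanishes exactly on tuples of nonnegative
  multiples of one vector.\<close>
definition defect :: "real ^ 'l ^ 'm \<Rightarrow> real" where
  "defect x = (\<Sum>j\<in>UNIV. norm (x $ j)) / real CARD('m) - norm (avg x)"

text \<open>The third summand of \<open>Phi\<close> yields this quantity, with \<open>A = m powr \<alpha>\<close>. On aligned tuples coming from
  \<open>MW W\<close> its nonnegativity says that the mean of \<open>(1 + v\<^sub>j)\<^sup>2\<close> is at most \<open>A\<close>.\<close>
definition gap :: "real \<Rightarrow> real ^ 'l ^ 'm \<Rightarrow> real" where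
  "gap A x = norm (avg x) - norm x / sqrt (A * real CARD('m))"

text \<open>What remains of the main inequality once \<open>y\<close>, \<open>z\<close>, \<open>t\<close> and \<open>s\<close> have been eliminated. A single
  parameter \<open>M\<close> is used in all places, so that enlarging it preserves the estimate and finitely many
  local estimates can be merged.\<close>
definition core_estimate ::
  "real \<Rightarrow> (real ^ 'l ^ 'm \<Rightarrow> real ^ 'm) \<Rightarrow> real \<Rightarrow> real ^ 'l ^ 'm \<Rightarrow> bool" where
  "core_estimate A \<psi> M x \<longleftrightarrow> 0 \<le> gap A x + M * defect x \<and>
     (\<forall>j. \<bar>\<psi> x $ j\<bar> \<le> M * (norm (avg x) - norm (x $ j) / A + M * (gap A x + M * defect x)))"

lemma linear_avg: "linear (avg :: 'a::real_vector ^ 'm \<Rightarrow> 'a)"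
  by (rule linearI) (simp_all add: avg_def sum.distrib scaleR_right_distrib scaleR_sum_right[symmetric])

lemma linear_centered: "linear (centered :: real ^ 'l ^ 'm \<Rightarrow> _)"
  by (rule linearI) (simp_all add: centered_def vec_eq_iff linear_add[OF linear_avg] linear_cmul[OF linear_avg] algebra_simps)

lemma avg_scaleR: "avg (c *\<^sub>R x) = c *\<^sub>R avg x"
  by (rule linear_cmul[OF linear_avg])

lemma sum_eq_avg: "(\<Sum>j\<in>UNIV. x $ j) = real CARD('m) *\<^sub>R avg (x :: 'a::real_vector ^ 'm)"
  by (simp add: avg_def)

lemma norm_avg_le: "norm (avg (x :: real ^ 'l ^ 'm)) \<le> norm x"
proof -
  have "norm (\<Sum>j\<in>UNIV. x $ j) \<le> (\<Sum>j\<in>(UNIV::'m set). norm x)"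
    by (rule sum_norm_le) (simp add: Finite_Cartesian_Product.norm_nth_le)
  then show ?thesis by (simp add: sum_eq_avg)
qed

lemma norm_vec_power2: "(norm (x :: real ^ 'l ^ 'm))\<^sup>2 = (\<Sum>j\<in>UNIV. (norm (x $ j))\<^sup>2)"
  by (simp add: norm_vec_def L2_set_def sum_nonneg)

text \<open>After multiplication by \<open>\<bar>avg x\<bar>\<close> the defect is a sum of Cauchy-Schwarz deficits, all nonnegative.
  Hence it controls each component separately.\<close>
lemma defect_mult_norm_avg:
  fixes x :: "real ^ 'l ^ 'm"
  shows "real CARD('m) * defect x * norm (avg x) =
    (\<Sum>j\<in>UNIV. norm (x $ j) * norm (avg x) - x $ j \<bullet> avg x)"
proof -
  have "(\<Sum>j\<in>UNIV. x $ j \<bullet> avg x) = real CARD('m) * (norm (avg x))\<^sup>2"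
    by (simp add: inner_sum_left[symmetric] sum_eq_avg power2_norm_eq_inner)
  then show ?thesis
    unfolding sum_subtractf sum_distrib_right[symmetric]
    by (simp add: defect_def power2_eq_square right_diff_distrib left_diff_distrib)
qed

lemma defect_nonneg: "0 \<le> defect (x :: real ^ 'l ^ 'm)"
proof -
  have "norm (\<Sum>j\<in>UNIV. x $ j) \<le> (\<Sum>j\<in>UNIV. norm (x $ j))"
    by (rule norm_sum)
  then show ?thesis by (simp add: defect_def sum_eq_avg field_simps)
qed

text \<open>Equality in every Cauchy-Schwarz deficit forces \<open>x\<^sub>j\<close> to be a nonnegative multiple of \<open>avg x\<close>, and the
  factors, which average to \<open>1\<close>, are the \<open>1 + v\<^sub>j\<close>.\<close>
lemma defect_eq_0_imp_MW:
  fixes x :: "real ^ 'l ^ 'm"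
  assumes x: "centered x \<in> W" "x \<noteq> 0" and D: "defect x = 0"
  obtains v where "v \<in> MW W" "avg x \<noteq> 0" "centered x = v \<otimes>\<^sub>v avg x"
    "\<And>j. x $ j = (1 + v $ j) *\<^sub>R avg x"
proof -
  let ?a = "avg x"
  have sn: "(\<Sum>j\<in>UNIV. norm (x $ j)) = real CARD('m) * norm ?a"
    using D by (simp add: defect_def field_simps)
  have a: "?a \<noteq> 0"
  proof
    assume "?a = 0"
    then have "\<forall>j. x $ j = 0" using sn by (simp add: sum_nonneg_eq_0_iff)
    then show False using x(2) by (simp add: vec_eq_iff)
  qed
  have "norm (x $ j) * norm ?a - x $ j \<bullet> ?a = 0" for j
    using defect_mult_norm_avg[of x] D
    by (simp add: sum_nonneg_eq_0_iff norm_cauchy_schwarz)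
  then have al: "norm (x $ j) *\<^sub>R ?a = norm ?a *\<^sub>R x $ j" for j
    using norm_cauchy_schwarz_eq[of "x $ j" ?a] by simp
  define v :: "real ^ 'm" where "v = (\<chi> j. norm (x $ j) / norm ?a - 1)"
  have xj: "x $ j = (1 + v $ j) *\<^sub>R ?a" for j
  proof -
    have "(1 + v $ j) *\<^sub>R ?a = (1 / norm ?a) *\<^sub>R (norm (x $ j) *\<^sub>R ?a)"
      by (simp add: v_def)
    also have "\<dots> = x $ j" unfolding al using a by simp
    finally show ?thesis by simp
  qed
  have c: "centered x = v \<otimes>\<^sub>v ?a"
  proof -
    have "x $ j - ?a = v $ j *\<^sub>R ?a" for j
      by (subst xj) (simp add: scaleR_left_distrib)
    then show ?thesis by (simp add: centered_def tensor_def vec_eq_iff)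
  qed
  have "(\<Sum>j\<in>UNIV. v $ j) = 0"
    using a sn by (simp add: v_def sum_subtractf sum_divide_distrib[symmetric])
  then have "v \<in> MW W"
    using x(1) c a by (auto simp: MW_def V_def) (auto simp: v_def)
  with a c xj show ?thesis using that by blast
qed

text \<open>When \<open>0 \<le> 1 + v\<^sub>j \<le> A\<close>, the right-hand side is a sum of nonnegative terms and vanishes only if \<open>1 + v\<close>
  takes no values besides \<open>0\<close> and \<open>A\<close>. This identifies the extremal tuples as the nonzero ones where
  both \<open>defect\<close> and \<open>gap\<close> are zero.\<close>
lemma power2_spread:
  fixes x :: "real ^ 'l ^ 'm"
  assumes v: "v \<in> V" and xj: "\<And>j. x $ j = (1 + v $ j) *\<^sub>R avg x"
  shows "A * real CARD('m) * (norm (avg x))\<^sup>2 - (norm x)\<^sup>2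
    = (\<Sum>j\<in>UNIV. (1 + v $ j) * (A - (1 + v $ j))) * (norm (avg x))\<^sup>2"
proof -
  have n: "(norm (x $ j))\<^sup>2 = (1 + v $ j)\<^sup>2 * (norm (avg x))\<^sup>2" for j
    by (subst xj) (simp add: power_mult_distrib)
  have s: "(\<Sum>j\<in>UNIV. 1 + v $ j) = real CARD('m)"
    using v by (simp add: V_def sum.distrib)
  have "A * real CARD('m) = (\<Sum>j\<in>UNIV. A * (1 + v $ j))"
    by (simp add: sum_distrib_left[symmetric] s)
  then have "A * real CARD('m) - (\<Sum>j\<in>UNIV. (1 + v $ j)\<^sup>2) = (\<Sum>j\<in>UNIV. (1 + v $ j) * (A - (1 + v $ j)))"
    by (simp add: sum_subtractf[symmetric] power2_eq_square algebra_simps)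
  moreover have "(norm x)\<^sup>2 = (\<Sum>j\<in>UNIV. (1 + v $ j)\<^sup>2) * (norm (avg x))\<^sup>2"
    by (simp add: norm_vec_power2 n sum_distrib_right)
  ultimately show ?thesis by (simp add: left_diff_distrib[symmetric])
qed

lemma gap_factor:
  fixes x :: "real ^ 'l ^ 'm"
  assumes "A > 0"
  shows "A * real CARD('m) * (norm (avg x))\<^sup>2 - (norm x)\<^sup>2 =
    gap A x * (A * real CARD('m) * norm (avg x) + sqrt (A * real CARD('m)) * norm x)"
proof -
  define q where "q = sqrt (A * real CARD('m))"
  have q: "q > 0" "A * real CARD('m) = q * q" using assms by (simp_all add: q_def)
  show ?thesis unfolding gap_def q_def[symmetric] q(2) using q(1)
    by (simp add: field_simps power2_eq_square)
qed

section \<open>The estimate near an extremal vector\<close>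

text \<open>
  Here \<open>e\<close> is the deviation from the extremal tuple equal to \<open>A a\<close> on \<open>H\<close> and to \<open>0\<close> elsewhere. In the
  difference of squares, which is \<open>gap\<close> up to a positive factor, the first-order contributions of \<open>H\<close>
  cancel and \<open>2 A (\<Sum>j\<notin>H. a \<bullet> e\<^sub>j)\<close> is left. The defect is at
  least the sum over \<open>j \<notin> H\<close> of \<open>\<bar>e\<^sub>j\<bar> \<bar>avg x\<bar> - e\<^sub>j \<bullet> avg x\<close>, which supplies the missing part, so the sum of
  both sees the full length \<open>\<bar>e\<^sub>j\<bar>\<close>, whatever the direction of \<open>e\<^sub>j\<close>.
\<close>
lemma expansion_near_extremal:
  fixes x e :: "real ^ 'l ^ 'm"
  assumes cardH: "real (card H) * A = real CARD('m)" and A: "A > 0"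
    and xH: "\<And>j. j \<in> H \<Longrightarrow> x $ j = A *\<^sub>R a + e $ j"
    and xn: "\<And>j. j \<notin> H \<Longrightarrow> x $ j = e $ j"
  defines "\<epsilon> \<equiv> \<Sum>j\<in>-H. norm (e $ j)"
  shows "avg x = a + avg e"
    and "A * real CARD('m) * (norm (avg x))\<^sup>2 - (norm x)\<^sup>2
           + 2 * A * real CARD('m) * defect x * norm (avg x)
         \<ge> 2 * A * \<epsilon> * (norm (avg x) - norm (avg e)) - (norm e)\<^sup>2"
proof -
  let ?m = "real CARD('m)"
  have split: "(\<Sum>j\<in>UNIV. f j) = (\<Sum>j\<in>H. f j) + (\<Sum>j\<in>-H. f j)" for f :: "'m \<Rightarrow> 'b::comm_monoid_add"
    using sum.union_disjoint[of H "-H" f] by (simp add: Compl_partition)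
  have "?m *\<^sub>R avg x = ?m *\<^sub>R (a + avg e)"
  proof -
    have "(\<Sum>j\<in>UNIV. x $ j) = (real (card H) * A) *\<^sub>R a + (\<Sum>j\<in>UNIV. e $ j)"
      unfolding split by (simp add: xH xn sum.distrib sum_constant_scaleR add.assoc del: sum_constant)
    then show ?thesis by (simp add: sum_eq_avg cardH scaleR_right_distrib)
  qed
  then show ax: "avg x = a + avg e" by simp
  have nx: "(norm x)\<^sup>2 = A * ?m * (norm a)\<^sup>2 + 2 * A * (\<Sum>j\<in>H. a \<bullet> e $ j) + (norm e)\<^sup>2"
  proof -
    have "(norm (x $ j))\<^sup>2 = A\<^sup>2 * (norm a)\<^sup>2 + 2 * A * (a \<bullet> e $ j) + (norm (e $ j))\<^sup>2" if "j \<in> H" for j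
      unfolding xH[OF that] power2_norm_eq_inner
      by (simp add: inner_add_left inner_add_right inner_commute power2_eq_square)
    then have "(norm x)\<^sup>2 = (real (card H) * A) * A * (norm a)\<^sup>2 + 2 * A * (\<Sum>j\<in>H. a \<bullet> e $ j) + (norm e)\<^sup>2"
      unfolding norm_vec_power2 split
      by (simp add: xn sum.distrib sum_distrib_left power2_eq_square)
    then show ?thesis unfolding cardH by simp
  qed
  have ae: "?m * (a \<bullet> avg e) = (\<Sum>j\<in>H. a \<bullet> e $ j) + (\<Sum>j\<in>-H. a \<bullet> e $ j)"
    unfolding split[symmetric] by (simp add: inner_sum_right[symmetric] sum_eq_avg)
  have "A * ?m * (norm (avg x))\<^sup>2 = A * ?m * (norm a)\<^sup>2 + 2 * A * (?m * (a \<bullet> avg e)) + A * ?m * (norm (avg e))\<^sup>2"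
    unfolding ax power2_norm_eq_inner
    by (simp add: inner_add_left inner_add_right inner_commute algebra_simps)
  then have N: "A * ?m * (norm (avg x))\<^sup>2 - (norm x)\<^sup>2 \<ge> 2 * A * (\<Sum>j\<in>-H. a \<bullet> e $ j) - (norm e)\<^sup>2"
    unfolding nx ae using A by (simp add: algebra_simps)
  have "?m * defect x * norm (avg x) \<ge> (\<Sum>j\<in>-H. norm (x $ j) * norm (avg x) - x $ j \<bullet> avg x)"
    unfolding defect_mult_norm_avg
    by (rule sum_mono2) (auto simp: norm_cauchy_schwarz)
  moreover have "(\<Sum>j\<in>-H. norm (x $ j) * norm (avg x) - x $ j \<bullet> avg x)
      \<ge> (\<Sum>j\<in>-H. norm (e $ j) * norm (avg x) - a \<bullet> e $ j - norm (e $ j) * norm (avg e))"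
  proof (rule sum_mono)
    fix j assume "j \<in> -H"
    then have "x $ j = e $ j" by (simp add: xn)
    moreover have "e $ j \<bullet> avg x \<le> a \<bullet> e $ j + norm (e $ j) * norm (avg e)"
      unfolding ax inner_add_right by (simp add: inner_commute[of a] norm_cauchy_schwarz)
    ultimately show "norm (e $ j) * norm (avg x) - a \<bullet> e $ j - norm (e $ j) * norm (avg e)
        \<le> norm (x $ j) * norm (avg x) - x $ j \<bullet> avg x" by simp
  qed
  moreover have "(\<Sum>j\<in>-H. norm (e $ j) * norm (avg x) - a \<bullet> e $ j - norm (e $ j) * norm (avg e))
     = \<epsilon> * (norm (avg x) - norm (avg e)) - (\<Sum>j\<in>-H. a \<bullet> e $ j)"
    by (simp add: \<epsilon>_def sum_subtractf sum_distrib_right right_diff_distrib)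
  ultimately have "\<epsilon> * (norm (avg x) - norm (avg e)) - (\<Sum>j\<in>-H. a \<bullet> e $ j) \<le> ?m * defect x * norm (avg x)"
    by linarith
  then have "2 * A * (\<epsilon> * (norm (avg x) - norm (avg e)) - (\<Sum>j\<in>-H. a \<bullet> e $ j)) \<le> 2 * A * (?m * defect x * norm (avg x))"
    using A by (intro mult_left_mono) auto
  then show "A * ?m * (norm (avg x))\<^sup>2 - (norm x)\<^sup>2 + 2 * A * ?m * defect x * norm (avg x)
         \<ge> 2 * A * \<epsilon> * (norm (avg x) - norm (avg e)) - (norm e)\<^sup>2"
    using N by (simp add: algebra_simps)
qed

text \<open>On the orthogonal complement of \<open>x0\<close> in \<open>X\<close> the restriction of tuples to the complement of \<open>H\<close> is
  injective, hence bounded below, as the dimension is finite.\<close>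
lemma nonlocal_distance_bound:
  fixes X :: "(real ^ 'l ^ 'm) set"
  assumes X: "subspace X" and x0: "x0 \<in> X" "x0 \<noteq> 0"
    and x0n: "\<And>j. j \<notin> H \<Longrightarrow> x0 $ j = 0"
    and ker: "\<And>x. x \<in> X \<Longrightarrow> (\<And>j. j \<notin> H \<Longrightarrow> x $ j = 0) \<Longrightarrow> \<exists>c. x = c *\<^sub>R x0"
  obtains K where "K > 0"
    "\<And>x. x \<in> X \<Longrightarrow> norm (x - (x \<bullet> x0 / (x0 \<bullet> x0)) *\<^sub>R x0) \<le> K * (\<Sum>j\<in>-H. norm (x $ j))"
proof -
  define Y where "Y = X \<inter> {y. x0 \<bullet> y = 0}"
  define T :: "real ^ 'l ^ 'm \<Rightarrow> real ^ 'l ^ 'm" where "T = (\<lambda>y. \<chi> j. if j \<in> H then 0 else y $ j)"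
  have Y: "subspace Y" unfolding Y_def by (intro subspace_inter X subspace_hyperplane)
  have T: "bounded_linear T"
    by (intro linear_conv_bounded_linear[THEN iffD1] linearI) (auto simp: T_def vec_eq_iff)
  have "y = 0" if "y \<in> Y" "T y = 0" for y
  proof -
    have "y $ j = 0" if "j \<notin> H" for j
      using \<open>T y = 0\<close> that by (auto simp: T_def vec_eq_iff split: if_splits)
    then have "\<exists>c. y = c *\<^sub>R x0" using that(1) by (intro ker) (auto simp: Y_def)
    then obtain c where "y = c *\<^sub>R x0" by blast
    with that(1) x0(2) show ?thesis by (auto simp: Y_def)
  qed
  then obtain k where k: "k > 0" "\<And>y. y \<in> Y \<Longrightarrow> k * norm y \<le> norm (T y)"
    using injective_imp_isometric[OF closed_subspace[OF Y] Y T] by (auto simp: mult.commute)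
  show ?thesis
  proof (rule that)
    show "1 / k > 0" using k by simp
    fix x assume x: "x \<in> X"
    define y where "y = x - (x \<bullet> x0 / (x0 \<bullet> x0)) *\<^sub>R x0"
    have "x0 \<bullet> y = 0" using x0(2) by (simp add: y_def inner_diff_right inner_commute)
    then have "y \<in> Y" using X x x0 by (simp add: Y_def y_def subspace_diff subspace_scale)
    have "norm (T y) \<le> (\<Sum>j\<in>UNIV. norm (T y $ j))"
      by (simp add: norm_vec_def L2_set_le_sum)
    also have "\<dots> = (\<Sum>j\<in>-H. norm (x $ j))"
      by (rule sum.mono_neutral_cong_right) (auto simp: T_def y_def x0n)
    finally show "norm y \<le> 1 / k * (\<Sum>j\<in>-H. norm (x $ j))"
      using k(1) k(2)[OF \<open>y \<in> Y\<close>] by (simp add: field_simps)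
  qed
qed

text \<open>
  Split \<open>x = c x0 + e\<close> orthogonally, so that \<open>e = O(\<epsilon>)\<close>. The expansion with \<open>a = c avg x0\<close> gives
  \<open>gap + 2 defect \<ge> \<epsilon> / (3 m)\<close>, and a large \<open>M\<close> turns this gain into a bound for the \<open>O(\<epsilon>)\<close> losses at \<open>j \<in> H\<close>.
\<close>
lemma core_estimate_near_extremal:
  fixes X :: "(real ^ 'l ^ 'm) set"
  assumes X: "subspace X" and \<psi>: "linear \<psi>" and x0: "x0 \<in> X" and A: "A \<ge> 1"
    and a: "avg x0 \<noteq> 0"
    and x0H: "\<And>j. j \<in> H \<Longrightarrow> x0 $ j = A *\<^sub>R avg x0"
    and x0n: "\<And>j. j \<notin> H \<Longrightarrow> x0 $ j = 0"
    and ker: "\<And>x. x \<in> X \<Longrightarrow> (\<And>j. j \<notin> H \<Longrightarrow> x $ j = 0) \<Longrightarrow> \<exists>c. x = c *\<^sub>R x0"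
    and cancel: "\<And>j. j \<in> H \<Longrightarrow> \<psi> x0 $ j = 0"
  shows "\<exists>M>0. \<forall>\<^sub>F x in nhds x0. x \<in> X \<longrightarrow> core_estimate A \<psi> M x"
proof -
  let ?m = "real CARD('m)" and ?a = "avg x0"
  have A0: "A > 0" using A by simp
  have x00: "x0 \<noteq> 0" using a linear_0[OF linear_avg] by metis
  have cardH: "real (card H) * A = ?m"
  proof -
    have "(\<Sum>j\<in>UNIV. x0 $ j) = (\<Sum>j\<in>H. x0 $ j)"
      by (rule sum.mono_neutral_right) (auto simp: x0n)
    also have "\<dots> = (real (card H) * A) *\<^sub>R ?a"
      by (simp add: x0H sum_constant_scaleR del: sum_constant)
    finally show ?thesis using a by (simp add: sum_eq_avg)
  qed
  obtain K where K: "K > 0"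
    "\<And>x. x \<in> X \<Longrightarrow> norm (x - (x \<bullet> x0 / (x0 \<bullet> x0)) *\<^sub>R x0) \<le> K * (\<Sum>j\<in>-H. norm (x $ j))"
    using nonlocal_distance_bound[OF X x0 x00 x0n ker] by blast
  obtain B where B: "B > 0" "\<And>x. norm (\<psi> x) \<le> B * norm x"
    using linear_bounded_pos[OF \<psi>] by blast
  define c where "c x = x \<bullet> x0 / (x0 \<bullet> x0)" for x
  define e where "e x = x - c x *\<^sub>R x0" for x
  \<comment> \<open>the gap vanishes at \<open>x0\<close>\<close>
  have nx0: "sqrt (A * ?m) * norm x0 = A * ?m * norm ?a"
  proof -
    have "gap A x0 * (A * ?m * norm ?a + sqrt (A * ?m) * norm x0) = A * ?m * (norm ?a)\<^sup>2 - (norm x0)\<^sup>2"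
      by (rule gap_factor[OF A0, symmetric])
    also have "(norm x0)\<^sup>2 = (\<Sum>j\<in>H. (norm (x0 $ j))\<^sup>2)"
      unfolding norm_vec_power2 by (rule sum.mono_neutral_right) (auto simp: x0n)
    also have "\<dots> = real (card H) * A * A * (norm ?a)\<^sup>2"
      by (simp add: x0H power_mult_distrib power2_eq_square)
    finally have "gap A x0 * (A * ?m * norm ?a + sqrt (A * ?m) * norm x0) = 0"
      unfolding cardH by simp
    moreover have "A * ?m * norm ?a + sqrt (A * ?m) * norm x0 > 0"
      using A0 a by (intro add_pos_nonneg) auto
    ultimately have "gap A x0 = 0" by simp
    then have "norm x0 = sqrt (A * ?m) * norm ?a"
      using A0 by (simp add: gap_def field_simps)
    then show ?thesis using A0 by simp
  qed
  have avg_lim: "((\<lambda>x. avg x) \<longlongrightarrow> ?a) (nhds x0)"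
    unfolding avg_def by (intro tendsto_intros filterlim_ident)
  have e_lim: "(e \<longlongrightarrow> 0) (nhds x0)"
  proof -
    have "(e \<longlongrightarrow> x0 - (x0 \<bullet> x0 / (x0 \<bullet> x0)) *\<^sub>R x0) (nhds x0)"
      unfolding e_def c_def by (intro tendsto_intros filterlim_ident) (use x00 in auto)
    then show ?thesis using x00 by simp
  qed
  have avg_e_lim: "((\<lambda>x. avg (e x)) \<longlongrightarrow> 0) (nhds x0)"
    unfolding avg_def using tendsto_scaleR[OF tendsto_const tendsto_sum[OF tendsto_vec_nth[OF e_lim]]]
    by fastforce
  have ev1: "\<forall>\<^sub>F x in nhds x0. A * norm ?a < 2 * A * norm (avg x) - 2 * A * norm (avg (e x)) - K * norm (e x)"
  proof (rule order_tendstoD)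
    show "((\<lambda>x. 2 * A * norm (avg x) - 2 * A * norm (avg (e x)) - K * norm (e x))
        \<longlongrightarrow> 2 * A * norm ?a - 2 * A * norm (0 :: real ^ 'l) - K * norm (0 :: real ^ 'l ^ 'm)) (nhds x0)"
      by (intro tendsto_intros avg_lim e_lim avg_e_lim)
    show "A * norm ?a < 2 * A * norm ?a - 2 * A * norm (0 :: real ^ 'l) - K * norm (0 :: real ^ 'l ^ 'm)"
      using A0 a by simp
  qed
  have ev2: "\<forall>\<^sub>F x in nhds x0. A * ?m * norm (avg x) + sqrt (A * ?m) * norm x < 3 * A * ?m * norm ?a"
  proof (rule order_tendstoD)
    show "((\<lambda>x. A * ?m * norm (avg x) + sqrt (A * ?m) * norm x)
        \<longlongrightarrow> A * ?m * norm ?a + sqrt (A * ?m) * norm x0) (nhds x0)"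
      by (intro tendsto_intros avg_lim filterlim_ident)
    show "A * ?m * norm ?a + sqrt (A * ?m) * norm x0 < 3 * A * ?m * norm ?a"
      unfolding nx0 using A0 a by simp
  qed
  have ev3: "\<forall>\<^sub>F x in nhds x0. \<forall>j\<in>-H. norm ?a / 2 < norm (avg x) - norm (x $ j) / A"
  proof (rule eventually_ball_finite)
    show "\<forall>j\<in>-H. \<forall>\<^sub>F x in nhds x0. norm ?a / 2 < norm (avg x) - norm (x $ j) / A"
    proof
      fix j assume "j \<in> -H"
      have "((\<lambda>x. norm (avg x) - norm (x $ j) / A) \<longlongrightarrow> norm ?a - norm (x0 $ j) / A) (nhds x0)"
        using A0 by (intro tendsto_intros avg_lim filterlim_ident) auto
      moreover have "norm ?a / 2 < norm ?a - norm (x0 $ j) / A"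
        using \<open>j \<in> -H\<close> a by (simp add: x0n)
      ultimately show "\<forall>\<^sub>F x in nhds x0. norm ?a / 2 < norm (avg x) - norm (x $ j) / A"
        by (rule order_tendstoD)
    qed
  qed simp
  have ev4: "\<forall>\<^sub>F x in nhds x0. norm x < norm x0 + 1"
    by (rule order_tendstoD(2)[OF tendsto_norm[OF filterlim_ident]]) simp
  \<comment> \<open>\<open>2\<close> lets \<open>M\<close> replace the factor of the defect; the second entry serves \<open>j \<in> H\<close> and the third \<open>j \<notin> H\<close>\<close>
  define M where "M = max (max 2 (3 * ?m * (2 * K + B * K))) (2 * B * (norm x0 + 1) / norm ?a)"
  have M: "M \<ge> 2" "M / (3 * ?m) \<ge> 2 * K + B * K" "M * (norm ?a / 2) \<ge> B * (norm x0 + 1)"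
  proof -
    have "M \<ge> 3 * ?m * (2 * K + B * K)" "M \<ge> 2 * B * (norm x0 + 1) / norm ?a"
      by (auto simp: M_def)
    with a show "M / (3 * ?m) \<ge> 2 * K + B * K" "M * (norm ?a / 2) \<ge> B * (norm x0 + 1)"
      by (simp_all add: field_simps)
  qed (simp add: M_def)
  have "\<forall>\<^sub>F x in nhds x0. x \<in> X \<longrightarrow> core_estimate A \<psi> M x"
    using ev1 ev2 ev3 ev4
  proof eventually_elim
    case (elim x)
    show ?case
    proof
      assume x: "x \<in> X"
      define \<epsilon> where "\<epsilon> = (\<Sum>j\<in>-H. norm (e x $ j))"
      have en: "x $ j = e x $ j" if "j \<notin> H" for j using that by (simp add: e_def x0n)
      have eH: "x $ j = A *\<^sub>R (c x *\<^sub>R ?a) + e x $ j" if "j \<in> H" for j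
        using that by (simp add: e_def x0H mult.commute)
      have eps0: "\<epsilon> \<ge> 0" by (simp add: \<epsilon>_def sum_nonneg)
      have Ke: "norm (e x) \<le> K * \<epsilon>"
        using K(2)[OF x] by (simp add: \<epsilon>_def en e_def[symmetric] c_def[symmetric])
      note E = expansion_near_extremal[OF cardH A0 eH en, folded \<epsilon>_def]
      \<comment> \<open>the factor by which the difference of squares exceeds the gap; it is close to \<open>2 A m \<bar>avg x0\<bar>\<close>\<close>
      define p where "p = A * ?m * norm (avg x) + sqrt (A * ?m) * norm x"
      have "norm (avg x) > 0"
      proof -
        have "0 < A * norm ?a" using A0 a by simp
        also have "\<dots> \<le> 2 * A * norm (avg x)"
        proof -
          have "0 \<le> 2 * A * norm (avg (e x))" "0 \<le> K * norm (e x)"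
            using A0 K by auto
          then show ?thesis using elim(1) by linarith
        qed
        finally show ?thesis using A0 by (simp add: zero_less_mult_iff)
      qed
      then have p: "p > 0" "A * ?m * norm (avg x) \<le> p"
        using A0 by (auto simp: p_def intro!: add_pos_nonneg)
      have "\<epsilon> * (A * norm ?a) \<le> p * (gap A x + 2 * defect x)"
      proof -
        have "\<epsilon> * (A * norm ?a) \<le> \<epsilon> * (2 * A * norm (avg x) - 2 * A * norm (avg (e x)) - K * norm (e x))"
          using elim(1) eps0 by (intro mult_left_mono) auto
        also have "\<dots> = 2 * A * \<epsilon> * (norm (avg x) - norm (avg (e x))) - (K * \<epsilon>) * norm (e x)"
          by (simp add: algebra_simps)
        also have "\<dots> \<le> 2 * A * \<epsilon> * (norm (avg x) - norm (avg (e x))) - (norm (e x))\<^sup>2"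
          using mult_right_mono[OF Ke, of "norm (e x)"] by (simp add: power2_eq_square)
        also have "\<dots> \<le> gap A x * p + 2 * (A * ?m * norm (avg x)) * defect x"
          using E(2) unfolding gap_factor[OF A0] p_def by (simp add: algebra_simps)
        also have "\<dots> \<le> gap A x * p + 2 * p * defect x"
          using p defect_nonneg[of x] by (intro add_left_mono mult_right_mono) auto
        finally show ?thesis by (simp add: algebra_simps)
      qed
      moreover have "\<epsilon> / (3 * ?m) * p \<le> \<epsilon> * (A * norm ?a)"
      proof -
        have "\<epsilon> / (3 * ?m) * p \<le> \<epsilon> / (3 * ?m) * (3 * A * ?m * norm ?a)"
          using elim(2) eps0 by (intro mult_left_mono) (auto simp: p_def)
        then show ?thesis by simp
      qed
      ultimately have "p * (\<epsilon> / (3 * ?m)) \<le> p * (gap A x + 2 * defect x)"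
        by (simp add: mult.commute)
      then have "\<epsilon> / (3 * ?m) \<le> gap A x + 2 * defect x"
        using p(1) by (rule mult_left_le_imp_le)
      also have "\<dots> \<le> gap A x + M * defect x"
        using M(1) defect_nonneg[of x] by (intro add_left_mono mult_right_mono)
      finally have S: "\<epsilon> / (3 * ?m) \<le> gap A x + M * defect x" .
      have S0: "0 \<le> gap A x + M * defect x"
        by (rule order_trans[OF _ S]) (use eps0 in auto)
      show "core_estimate A \<psi> M x"
        unfolding core_estimate_def
      proof (intro conjI allI S0)
        fix j
        show "\<bar>\<psi> x $ j\<bar> \<le> M * (norm (avg x) - norm (x $ j) / A + M * (gap A x + M * defect x))"
        proof (cases "j \<in> H")
          case False
          have "\<bar>\<psi> x $ j\<bar> \<le> B * norm x"
            using order_trans[OF component_le_norm_cart B(2)] by blast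
          also have "\<dots> \<le> B * (norm x0 + 1)"
            using elim(4) B(1) by (intro mult_left_mono) auto
          also have "\<dots> \<le> M * (norm ?a / 2)" by (rule M(3))
          also have "\<dots> \<le> M * (norm (avg x) - norm (x $ j) / A + M * (gap A x + M * defect x))"
          proof (rule mult_left_mono)
            have "0 \<le> M * (gap A x + M * defect x)" using S0 M(1) by (intro mult_nonneg_nonneg) auto
            moreover have "norm ?a / 2 < norm (avg x) - norm (x $ j) / A"
              using elim(3) False by blast
            ultimately show "norm ?a / 2 \<le> norm (avg x) - norm (x $ j) / A + M * (gap A x + M * defect x)"
              by linarith
          qed (use M(1) in auto)
          finally show ?thesis .
        next
          case True
          have "\<psi> x = c x *\<^sub>R \<psi> x0 + \<psi> (e x)"
            by (simp add: e_def linear_diff[OF \<psi>] linear_cmul[OF \<psi>])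
          then have "\<bar>\<psi> x $ j\<bar> = \<bar>\<psi> (e x) $ j\<bar>" by (simp add: cancel[OF True])
          also have "\<dots> \<le> B * norm (e x)"
            using order_trans[OF component_le_norm_cart B(2)] by blast
          also have "\<dots> \<le> B * (K * \<epsilon>)" using Ke B(1) by (intro mult_left_mono) auto
          finally have 1: "\<bar>\<psi> x $ j\<bar> \<le> B * K * \<epsilon>" by simp
          have "norm (x $ j) / A \<le> norm (c x *\<^sub>R ?a) + norm (e x)"
          proof -
            have "norm (x $ j) \<le> A * norm (c x *\<^sub>R ?a) + norm (e x $ j)"
              unfolding eH[OF True] using A0 norm_triangle_ineq[of "A *\<^sub>R (c x *\<^sub>R ?a)" "e x $ j"] by (simp add: abs_mult)
            also have "\<dots> \<le> A * norm (c x *\<^sub>R ?a) + A * norm (e x)"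
              using Finite_Cartesian_Product.norm_nth_le[of "e x" j] A
                mult_right_mono[OF A norm_ge_zero[of "e x"]] by simp
            finally show ?thesis using A0 by (simp add: field_simps)
          qed
          moreover have "norm (c x *\<^sub>R ?a) - norm (e x) \<le> norm (avg x)"
            using norm_diff_ineq[of "c x *\<^sub>R ?a" "avg (e x)"] norm_avg_le[of "e x"]
            by (simp add: E(1)[symmetric])
          ultimately have 2: "- 2 * K * \<epsilon> \<le> norm (avg x) - norm (x $ j) / A"
            using Ke by linarith
          have "B * K * \<epsilon> \<le> - 2 * K * \<epsilon> + M / (3 * ?m) * \<epsilon>"
            using mult_right_mono[OF M(2) eps0] by (simp add: algebra_simps)
          also have "\<dots> \<le> norm (avg x) - norm (x $ j) / A + M * (gap A x + M * defect x)"
            using mult_left_mono[OF S, of M] M(1) 2 by simp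
          finally have 3: "B * K * \<epsilon> \<le> norm (avg x) - norm (x $ j) / A + M * (gap A x + M * defect x)" .
          have "0 \<le> B * K * \<epsilon>" using B K eps0 by simp
          with 3 have "1 * (B * K * \<epsilon>) \<le> M * (norm (avg x) - norm (x $ j) / A + M * (gap A x + M * defect x))"
            using M(1) by (intro mult_mono) auto
          then show ?thesis using 1 by simp
        qed
      qed
    qed
  qed
  then show ?thesis using M(1) by (intro exI[of _ M]) auto
qed

section \<open>From local to global\<close>

text \<open>The last factor \<open>F\<^sub>j + M (gap + M defect)\<close> cannot be negative, since \<open>M\<close> times it bounds an absolute
  value; so all factors may be enlarged.\<close>
lemma core_estimate_mono:
  fixes x :: "real ^ 'l ^ 'm"
  assumes core: "core_estimate A \<psi> M x" and M: "0 < M" "M \<le> M'"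
  shows "core_estimate A \<psi> M' x"
proof -
  let ?S = "\<lambda>M. gap A x + M * defect x"
  have S: "0 \<le> ?S M" "?S M \<le> ?S M'"
    using assms defect_nonneg[of x] by (auto simp: core_estimate_def intro: mult_right_mono)
  have "\<bar>\<psi> x $ j\<bar> \<le> M' * (norm (avg x) - norm (x $ j) / A + M' * ?S M')" for j
  proof -
    let ?F = "norm (avg x) - norm (x $ j) / A"
    have 1: "\<bar>\<psi> x $ j\<bar> \<le> M * (?F + M * ?S M)"
      using core by (simp add: core_estimate_def)
    then have "0 \<le> M * (?F + M * ?S M)" by (rule order_trans[rotated]) simp
    then have 2: "0 \<le> ?F + M * ?S M" using M(1) by (simp add: zero_le_mult_iff)
    have "M * ?S M \<le> M' * ?S M'" using S M by (intro mult_mono) auto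
    then have "M * (?F + M * ?S M) \<le> M' * (?F + M' * ?S M')"
      using M 2 by (intro mult_mono) auto
    with 1 show ?thesis by (rule order_trans)
  qed
  then show ?thesis using S by (simp add: core_estimate_def)
qed

lemma core_estimate_scaleR:
  fixes x :: "real ^ 'l ^ 'm"
  assumes core: "core_estimate A \<psi> M x" and \<psi>: "linear \<psi>" and r: "0 \<le> r"
  shows "core_estimate A \<psi> M (r *\<^sub>R x)"
proof -
  have d: "defect (r *\<^sub>R x) = r * defect x"
    using r by (simp add: defect_def avg_scaleR sum_distrib_left[symmetric] right_diff_distrib)
  have g: "gap A (r *\<^sub>R x) = r * gap A x"
    using r by (simp add: gap_def avg_scaleR right_diff_distrib)
  have "0 \<le> r * (gap A x + M * defect x)"
    using core r by (simp add: core_estimate_def)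
  moreover have "\<bar>r * \<psi> x $ j\<bar> \<le> r * (M * (norm (avg x) - norm (x $ j) / A + M * (gap A x + M * defect x)))" for j
    using core r by (auto simp: core_estimate_def abs_mult intro!: mult_left_mono)
  ultimately show ?thesis
    using r by (simp add: core_estimate_def d g linear_cmul[OF \<psi>] avg_scaleR algebra_simps)
qed

text \<open>As soon as \<open>gap + M defect\<close> stays above some \<open>\<sigma> > 0\<close> for large \<open>M\<close>, the term \<open>M \<sigma>\<close> outweighs
  \<open>\<bar>\<psi> x0\<bar>\<close> and any negative \<open>F\<^sub>j\<close>; the resulting strict inequalities are open conditions.\<close>
lemma core_estimate_near_strict:
  fixes x0 :: "real ^ 'l ^ 'm"
  assumes \<psi>: "linear \<psi>" and A: "A \<ge> 1"
    and pos: "defect x0 > 0 \<or> (defect x0 = 0 \<and> gap A x0 > 0)"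
  shows "\<exists>M>0. \<forall>\<^sub>F x in nhds x0. core_estimate A \<psi> M x"
proof -
  obtain \<sigma> M0 where \<sigma>: "\<sigma> > 0" "\<And>M. M \<ge> M0 \<Longrightarrow> gap A x0 + M * defect x0 \<ge> \<sigma>"
  proof (cases "defect x0 > 0")
    case True
    show ?thesis
    proof (rule that[of 1 "(1 - gap A x0) / defect x0"])
      fix M assume "M \<ge> (1 - gap A x0) / defect x0"
      then show "gap A x0 + M * defect x0 \<ge> 1" using True by (simp add: field_simps)
    qed simp
  next
    case False
    with pos show ?thesis by (intro that[of "gap A x0" 0]) auto
  qed
  define P where "P = norm x0 + norm (\<psi> x0) + 1"
  define M where "M = max (max 1 M0) (P / \<sigma>)"
  have M: "M \<ge> 1" "M \<ge> M0" by (auto simp: M_def)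
  have "M \<ge> P / \<sigma>" by (simp add: M_def)
  then have M\<sigma>: "M * \<sigma> \<ge> P" using \<sigma>(1) by (simp add: field_simps)
  let ?S = "\<lambda>x. gap A x + M * defect x"
  let ?R = "\<lambda>j x. M * (norm (avg x) - norm (x $ j) / A + M * ?S x) - \<bar>\<psi> x $ j\<bar>"
  have \<psi>lim: "(\<psi> \<longlongrightarrow> \<psi> x0) (nhds x0)"
    using linear_continuous_at[OF \<psi>[unfolded linear_conv_bounded_linear], of x0]
    by (simp add: continuous_at tendsto_nhds_iff)
  have avg_lim: "(avg \<longlongrightarrow> avg x0) (nhds x0)"
    unfolding avg_def by (intro tendsto_intros filterlim_ident)
  have S_lim: "(?S \<longlongrightarrow> ?S x0) (nhds x0)"
    unfolding gap_def defect_def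
    by (intro tendsto_intros avg_lim filterlim_ident) (use A in auto)
  have R_lim: "(?R j \<longlongrightarrow> ?R j x0) (nhds x0)" for j
    by (intro tendsto_intros avg_lim filterlim_ident S_lim \<psi>lim) (use A in auto)
  have R_pos: "0 < ?R j x0" for j
  proof -
    have "norm (x0 $ j) / A \<le> norm x0 / 1"
      using A Finite_Cartesian_Product.norm_nth_le[of x0 j] by (intro frac_le) auto
    moreover have "M * \<sigma> \<le> M * ?S x0" using M \<sigma>(2)[of M] by (intro mult_left_mono) auto
    moreover have "\<bar>\<psi> x0 $ j\<bar> \<le> norm (\<psi> x0)" by (rule component_le_norm_cart)
    ultimately have 1: "\<bar>\<psi> x0 $ j\<bar> + 1 \<le> norm (avg x0) - norm (x0 $ j) / A + M * ?S x0"
      using M\<sigma> norm_ge_zero[of "avg x0"] unfolding P_def by linarith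
    have "1 * (\<bar>\<psi> x0 $ j\<bar> + 1) \<le> M * (norm (avg x0) - norm (x0 $ j) / A + M * ?S x0)"
      using M 1 by (intro mult_mono) auto
    then show ?thesis by simp
  qed
  have "0 < ?S x0" using \<sigma> M by fastforce
  then have "\<forall>\<^sub>F x in nhds x0. 0 < ?S x" by (rule order_tendstoD(1)[OF S_lim])
  moreover have "\<forall>\<^sub>F x in nhds x0. \<forall>j. 0 < ?R j x"
    by (rule eventually_all_finite) (rule order_tendstoD(1)[OF R_lim R_pos])
  ultimately have "\<forall>\<^sub>F x in nhds x0. core_estimate A \<psi> M x"
    by eventually_elim (auto simp: core_estimate_def intro: less_imp_le)
  then show ?thesis using M by (intro exI[of _ M]) auto
qed

text \<open>The dichotomy: either the strict case applies, or defect and gap both vanish at \<open>x0\<close>. In the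
  second case \<open>centered x0\<close> is an extremal vector \<open>v \<otimes>\<^sub>v avg x0\<close>, and nonlocality and canceling provide the
  hypotheses of the extremal estimate for \<open>H = supp v\<close>.\<close>
lemma core_estimate_local:
  fixes W :: "(real ^ 'l ^ 'm) set"
  assumes m: "CARD('m) \<ge> 2" and W: "subspace W" and geo: "geometric W" and nonloc: "nonlocal W"
    and alpha: "0 < order_alpha W"
    and canc: "canceling W \<phi>" and \<psi>: "linear \<psi>" and \<psi>\<phi>: "\<And>x. centered x \<in> W \<Longrightarrow> \<psi> x = \<phi> (centered x)"
    and x0: "centered x0 \<in> W" "x0 \<noteq> 0"
  shows "\<exists>M>0. \<forall>\<^sub>F x in nhds x0. centered x \<in> W \<longrightarrow>
    core_estimate (real CARD('m) powr order_alpha W) \<psi> M x"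
proof -
  let ?m = "real CARD('m)"
  define A where "A = ?m powr order_alpha W"
  have A1: "A > 1" using m alpha by (simp add: A_def)
  have "\<exists>M>0. \<forall>\<^sub>F x in nhds x0. centered x \<in> W \<longrightarrow> core_estimate A \<psi> M x"
  proof (cases "defect x0 > 0 \<or> (defect x0 = 0 \<and> gap A x0 > 0)")
    case True
    then obtain M where "M > 0" "\<forall>\<^sub>F x in nhds x0. core_estimate A \<psi> M x"
      using core_estimate_near_strict[OF \<psi>, of A x0] A1 by auto
    then show ?thesis by (auto elim: eventually_mono)
  next
    case False
    then have D: "defect x0 = 0" "gap A x0 \<le> 0" using defect_nonneg[of x0] by auto
    obtain v where v: "v \<in> MW W" and a: "avg x0 \<noteq> 0" and c: "centered x0 = v \<otimes>\<^sub>v avg x0"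
      and xj: "\<And>j. x0 $ j = (1 + v $ j) *\<^sub>R avg x0"
      using defect_eq_0_imp_MW[OF x0 D(1)] by blast
    have v0: "0 \<le> 1 + v $ j" for j using v by (simp add: MW_def) (smt (verit))
    have vA: "1 + v $ j \<le> A" for j
      using geometric_MW_bound[OF m geo v] by (simp add: A_def)
    have prod0: "0 \<le> (1 + v $ j) * (A - (1 + v $ j))" for j using v0 vA by simp
    have "(\<Sum>j\<in>UNIV. (1 + v $ j) * (A - (1 + v $ j))) * (norm (avg x0))\<^sup>2
        = gap A x0 * (A * ?m * norm (avg x0) + sqrt (A * ?m) * norm x0)"
      using power2_spread[of v x0 A] v xj gap_factor[of A x0] A1 by (simp add: MW_def)
    also have "\<dots> \<le> 0" using D(2) A1 by (intro mult_nonpos_nonneg) auto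
    finally have "(\<Sum>j\<in>UNIV. (1 + v $ j) * (A - (1 + v $ j))) \<le> 0"
      using a by (simp add: mult_le_0_iff)
    then have "(\<Sum>j\<in>UNIV. (1 + v $ j) * (A - (1 + v $ j))) = 0"
      using prod0 by (intro antisym sum_nonneg) auto
    then have "(1 + v $ j) * (A - (1 + v $ j)) = 0" for j
      using prod0 by (simp add: sum_nonneg_eq_0_iff)
    then have two: "1 + v $ j = 0 \<or> 1 + v $ j = A" for j by (metis diff_eq_diff_eq diff_self mult_eq_0_iff)
    have ext: "extremal W v (avg x0)"
      using extremal_if_two_valued[OF m v a] x0(1) c two by (simp add: A_def)
    show ?thesis
    proof (rule core_estimate_near_extremal[where X = "{x. centered x \<in> W}" and H = "supp v", unfolded mem_Collect_eq])
      show "subspace {x. centered x \<in> W}"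
        using linear_subspace_vimage[OF linear_centered W] by (simp add: vimage_def)
      show "linear \<psi>" "centered x0 \<in> W" "1 \<le> A" "avg x0 \<noteq> 0" using \<psi> x0 A1 a by auto
      show "x0 $ j = A *\<^sub>R avg x0" if "j \<in> supp v" for j
        using that two[of j] xj[of j] by (simp add: supp_def)
      show "x0 $ j = 0" if "j \<notin> supp v" for j
        using that xj[of j] by (simp add: supp_def)
      show "\<psi> x0 $ j = 0" if "j \<in> supp v" for j
        using canc ext that \<psi>\<phi>[OF x0(1)] c by (simp add: canceling_def)
      fix x assume x: "centered x \<in> W" and xs: "\<And>j. j \<notin> supp v \<Longrightarrow> x $ j = 0"
      have "\<forall>j. j \<notin> supp v \<longrightarrow> avg x + centered x $ j = 0"
        using xs by (simp add: centered_def)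
      then obtain k where k: "centered x = k *\<^sub>R (v \<otimes>\<^sub>v avg x0)"
        using nonloc ext x unfolding nonlocal_def by blast
      have xk: "x $ j = avg x + (k * v $ j) *\<^sub>R avg x0" for j
        using k by (simp add: centered_def tensor_def vec_eq_iff diff_eq_eq add.commute)
      \<comment> \<open>otherwise \<open>1 + v = A > 1\<close> everywhere, against \<open>v\<close> having mean zero; an index outside the support
        ties \<open>avg x\<close>, on which \<open>centered x\<close> carries no information, to the factor \<open>k\<close>\<close>
      have "\<exists>i. i \<notin> supp v"
      proof (rule ccontr)
        assume "\<nexists>i. i \<notin> supp v"
        then have "1 + v $ j = A" for j using two[of j] by (auto simp: supp_def)
        then have "(\<Sum>j\<in>(UNIV::'m set). v $ j) = (\<Sum>j\<in>(UNIV::'m set). A - 1)"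
          by (intro sum.cong) (auto simp: algebra_simps)
        then show False using v A1 by (simp add: MW_def V_def)
      qed
      then obtain i where i: "i \<notin> supp v" by blast
      then have "avg x = k *\<^sub>R avg x0"
        using xk[of i] xs[of i] by (simp add: supp_def add_eq_0_iff)
      then have "x $ j = (k *\<^sub>R x0) $ j" for j
        unfolding xk[of j] using xj[of j] by (simp add: algebra_simps)
      then show "\<exists>k. x = k *\<^sub>R x0" by (auto simp: vec_eq_iff)
    qed
  qed
  then show ?thesis by (simp add: A_def)
qed

lemma core_estimate_uniform:
  fixes X :: "(real ^ 'l ^ 'm) set"
  assumes X: "subspace X" and \<psi>: "linear \<psi>"
    and loc: "\<And>x0. x0 \<in> X \<Longrightarrow> x0 \<noteq> 0 \<Longrightarrow> \<exists>M>0. \<forall>\<^sub>F x in nhds x0. x \<in> X \<longrightarrow> core_estimate A \<psi> M x"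
  shows "\<exists>M>0. \<forall>x\<in>X. core_estimate A \<psi> M x"
proof -
  let ?S = "sphere 0 1 \<inter> X"
  have comp: "compact ?S" by (intro compact_Int_closed closed_subspace X) simp
  define good where "good x0 M U \<longleftrightarrow> M > 0 \<and> open U \<and> x0 \<in> U \<and> (\<forall>x\<in>U. x \<in> X \<longrightarrow> core_estimate A \<psi> M x)"
    for x0 M U
  have "\<exists>M U. good x0 M U" if "x0 \<in> ?S" for x0
  proof -
    have "x0 \<in> X" "x0 \<noteq> 0" using that by auto
    from loc[OF this] show ?thesis unfolding eventually_nhds good_def by blast
  qed
  then obtain M U where "\<And>x0. x0 \<in> ?S \<Longrightarrow> good x0 (M x0) (U x0)"
    by metis
  then have MU: "\<And>x0. x0 \<in> ?S \<Longrightarrow> M x0 > 0" "\<And>x0. x0 \<in> ?S \<Longrightarrow> open (U x0)"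
    "\<And>x0. x0 \<in> ?S \<Longrightarrow> x0 \<in> U x0" "\<And>x0 x. x0 \<in> ?S \<Longrightarrow> x \<in> U x0 \<Longrightarrow> x \<in> X \<Longrightarrow> core_estimate A \<psi> (M x0) x"
    unfolding good_def by blast+
  have cover: "?S \<subseteq> (\<Union>x0\<in>?S. U x0)"
    using MU(3) by (intro subsetI UN_I)
  obtain C where C: "C \<subseteq> ?S" "finite C" "?S \<subseteq> (\<Union>x0\<in>C. U x0)"
    by (rule compactE_image[OF comp MU(2) cover])
  define N where "N = Max (insert 1 (M ` C))"
  have N: "1 \<le> N" "\<And>x0. x0 \<in> C \<Longrightarrow> M x0 \<le> N"
    using C(2) by (auto simp: N_def)
  have sphere: "core_estimate A \<psi> N u" if u: "u \<in> ?S" for u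
  proof -
    obtain x0 where x0: "x0 \<in> C" "u \<in> U x0" using C(3) u by blast
    then have "x0 \<in> ?S" using C(1) by blast
    with x0 u show ?thesis
      by (intro core_estimate_mono[OF MU(4)[of x0 u] MU(1) N(2)]) auto
  qed
  have "core_estimate A \<psi> N x" if x: "x \<in> X" for x
  proof (cases "x = 0")
    case True
    then show ?thesis
      by (simp add: core_estimate_def gap_def defect_def linear_0[OF linear_avg] linear_0[OF \<psi>])
  next
    case False
    then have "(1 / norm x) *\<^sub>R x \<in> ?S"
      using subspace_scale[OF X x, of "1 / norm x"] by simp
    from core_estimate_scaleR[OF sphere[OF this] \<psi>, of "norm x"] False
    show ?thesis by simp
  qed
  then show ?thesis using N(1) by (intro exI[of _ N]) auto
qed

section \<open>The supersolution\<close>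

text \<open>
  The hypothesis \<open>s\<^sub>j \<le> S A / m\<close> makes both the third and the fourth summand work: it lets \<open>\<surd>s\<^sub>j\<close> and
  \<open>s\<^sub>j\<close> be pulled out of the sums. With \<open>E = gap + M defect\<close>, the core estimate gives
  \<open>\<bar>\<psi>\<^sub>j x\<bar> \<le> C1 F\<^sub>j + C2 E\<close>, and \<open>C2 E T\<close> with \<open>T = (\<Sum>j. t\<^sub>j)\<close> is paid for by the
  third and fourth summands because \<open>E \<ge> 0\<close> and \<open>T \<le> \<surd>(S T) \<le> S\<close>.
\<close>
lemma main_inequality_if_core_estimate:
  fixes x :: "real ^ 'l ^ 'm"
  assumes A: "A \<ge> 1" and M: "M > 0" and core: "core_estimate A \<psi> M x"
    and C1: "C1 \<ge> M" and C2: "C2 \<ge> C1 * M" and C3: "C3 \<ge> C2 * M"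
    and om: "\<And>j. norm (x $ j) \<le> z $ j" "\<And>j. 0 \<le> t $ j" "\<And>j. t $ j \<le> s $ j"
    and S: "tot t \<le> S" "\<And>j. s $ j \<le> S * A / real CARD('m)"
  shows "(\<Sum>j\<in>UNIV. Phi C1 C2 C3 (x $ j, A * y + \<psi> x $ j, z $ j, t $ j, s $ j)) / A
    \<le> Phi C1 C2 C3 (avg x, y, avg z, tot t, S)"
proof -
  let ?m = "real CARD('m)"
  have A0: "A > 0" using A by simp
  have C0: "C1 > 0" "C2 \<ge> 0" "C3 \<ge> 0"
  proof -
    show 1: "C1 > 0" using C1 M by simp
    show 2: "C2 \<ge> 0" using C2 1 M by (meson less_imp_le mult_nonneg_nonneg order_trans)
    show "C3 \<ge> 0" using C3 2 M by (meson less_imp_le mult_nonneg_nonneg order_trans)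
  qed
  define T where "T = tot t"
  define r where "r = sqrt (S * T)"
  define F where "F j = norm (avg x) - norm (x $ j) / A" for j
  define E where "E = gap A x + M * defect x"
  have T0: "0 \<le> T" using om by (simp add: T_def tot_def sum_nonneg)
  have TS: "T \<le> S" using S by (simp add: T_def)
  have r: "T \<le> r" "r \<le> S" "0 \<le> r"
    unfolding r_def using T0 TS
    by (auto intro!: real_le_rsqrt real_le_lsqrt simp: power2_eq_square mult_mono)
  have s0: "0 \<le> s $ j" for j using om order_trans by blast
  have P1: "(\<Sum>j\<in>UNIV. \<bar>A * y + \<psi> x $ j\<bar> * t $ j) / A \<le> \<bar>y\<bar> * T + (\<Sum>j\<in>UNIV. \<bar>\<psi> x $ j\<bar> * t $ j)"
  proof -
    have "(\<Sum>j\<in>UNIV. \<bar>A * y + \<psi> x $ j\<bar> * t $ j) / A = (\<Sum>j\<in>UNIV. \<bar>A * y + \<psi> x $ j\<bar> / A * t $ j)"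
      by (simp add: sum_divide_distrib)
    also have "\<dots> \<le> (\<Sum>j\<in>UNIV. (\<bar>y\<bar> + \<bar>\<psi> x $ j\<bar>) * t $ j)"
    proof (intro sum_mono mult_right_mono om)
      fix j
      have "\<bar>A * y + \<psi> x $ j\<bar> \<le> A * \<bar>y\<bar> + \<bar>\<psi> x $ j\<bar>"
        using A0 abs_triangle_ineq[of "A * y" "\<psi> x $ j"] by (simp add: abs_mult)
      also have "\<dots> \<le> A * (\<bar>y\<bar> + \<bar>\<psi> x $ j\<bar>)"
        using mult_right_mono[OF A abs_ge_zero[of "\<psi> x $ j"]] by (simp add: distrib_left)
      finally show "\<bar>A * y + \<psi> x $ j\<bar> / A \<le> \<bar>y\<bar> + \<bar>\<psi> x $ j\<bar>"
        using A0 by (simp add: pos_divide_le_eq mult.commute)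
    qed
    finally show ?thesis by (simp add: distrib_right sum.distrib T_def tot_def sum_distrib_left)
  qed
  have P2: "norm (avg x) * T - (\<Sum>j\<in>UNIV. norm (x $ j) * t $ j) / A = (\<Sum>j\<in>UNIV. F j * t $ j)"
    by (simp add: F_def T_def tot_def left_diff_distrib sum_subtractf sum_distrib_left sum_divide_distrib)
  have P3: "(\<Sum>j\<in>UNIV. norm (x $ j) * sqrt (s $ j * t $ j)) / A \<le> norm (avg x) * r - gap A x * r"
  proof -
    have "(\<Sum>j\<in>UNIV. norm (x $ j) * sqrt (s $ j * t $ j)) \<le> (\<Sum>j\<in>UNIV. norm (x $ j) * (sqrt (S * A / ?m) * sqrt (t $ j)))"
      unfolding real_sqrt_mult[symmetric]
      by (intro sum_mono mult_left_mono real_sqrt_le_mono mult_right_mono S om) auto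
    also have "\<dots> = sqrt (S * A / ?m) * (\<Sum>j\<in>UNIV. norm (x $ j) * sqrt (t $ j))"
      by (simp add: sum_distrib_left mult_ac)
    also have "\<dots> \<le> sqrt (S * A / ?m) * (norm x * sqrt T)"
    proof (rule mult_left_mono)
      have "(\<Sum>j\<in>UNIV. \<bar>norm (x $ j)\<bar> * \<bar>sqrt (t $ j)\<bar>) \<le> L2_set (\<lambda>j. norm (x $ j)) UNIV * L2_set (\<lambda>j. sqrt (t $ j)) UNIV"
        by (rule L2_set_mult_ineq)
      then show "(\<Sum>j\<in>UNIV. norm (x $ j) * sqrt (t $ j)) \<le> norm x * sqrt T"
        using om by (simp add: norm_vec_def[of x] L2_set_def T_def tot_def)
    qed (use T0 TS A0 in auto)
    also have "\<dots> = A * (norm x / sqrt (A * ?m) * r)"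
      using A0 by (simp add: r_def real_sqrt_mult real_sqrt_divide field_simps)
    finally show ?thesis
      using A0 by (simp add: gap_def pos_divide_le_eq algebra_simps)
  qed
  have P4: "(\<Sum>j\<in>UNIV. (z $ j - norm (x $ j)) * s $ j) / A \<le> (avg z - norm (avg x)) * S - defect x * S"
  proof -
    have "(\<Sum>j\<in>UNIV. (z $ j - norm (x $ j)) * s $ j) \<le> (\<Sum>j\<in>UNIV. (z $ j - norm (x $ j)) * (S * A / ?m))"
      using om by (intro sum_mono mult_left_mono S) auto
    also have "\<dots> = (avg z - (\<Sum>j\<in>UNIV. norm (x $ j)) / ?m) * S * A"
      unfolding sum_distrib_right[symmetric] sum_subtractf
      by (simp add: avg_def left_diff_distrib diff_divide_distrib)
    finally have "(\<Sum>j\<in>UNIV. (z $ j - norm (x $ j)) * s $ j) / A \<le> (avg z - (\<Sum>j\<in>UNIV. norm (x $ j)) / ?m) * S"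
      using A0 by (simp add: pos_divide_le_eq)
    then show ?thesis by (simp add: defect_def left_diff_distrib)
  qed
  have E0: "0 \<le> E" using core by (simp add: core_estimate_def E_def)
  have step: "(\<Sum>j\<in>UNIV. \<bar>\<psi> x $ j\<bar> * t $ j) \<le> (\<Sum>j\<in>UNIV. (C1 * F j + C2 * E) * t $ j)"
  proof (intro sum_mono mult_right_mono om)
    fix j
    have 1: "\<bar>\<psi> x $ j\<bar> \<le> M * (F j + M * E)"
      using core by (simp add: core_estimate_def F_def E_def)
    then have "0 \<le> M * (F j + M * E)" by (rule order_trans[rotated]) simp
    then have "0 \<le> F j + M * E" using M by (simp add: zero_le_mult_iff)
    then have "M * (F j + M * E) \<le> C1 * (F j + M * E)" using C1 by (intro mult_right_mono)
    moreover have "(C1 * M) * E \<le> C2 * E" using C2 E0 by (rule mult_right_mono)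
    ultimately show "\<bar>\<psi> x $ j\<bar> \<le> C1 * F j + C2 * E"
      using 1 by (simp add: algebra_simps)
  qed
  also have "\<dots> = C1 * (\<Sum>j\<in>UNIV. F j * t $ j) + C2 * E * T"
    by (simp add: distrib_right sum.distrib sum_distrib_left T_def tot_def mult.assoc)
  also have "C2 * E * T \<le> C2 * E * r" using r C0 E0 by (intro mult_left_mono) auto
  also have "C2 * E * r = C2 * gap A x * r + C2 * M * (defect x * r)"
    by (simp add: E_def algebra_simps)
  also have "C2 * M * (defect x * r) \<le> C3 * (defect x * S)"
    using C3 C0 r defect_nonneg[of x] by (intro mult_mono) auto
  finally have fin: "(\<Sum>j\<in>UNIV. \<bar>\<psi> x $ j\<bar> * t $ j)
    \<le> C1 * (\<Sum>j\<in>UNIV. F j * t $ j) + (C2 * gap A x * r + C3 * (defect x * S))" by simp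
  have "(\<Sum>j\<in>UNIV. Phi C1 C2 C3 (x $ j, A * y + \<psi> x $ j, z $ j, t $ j, s $ j)) / A
     = (\<Sum>j\<in>UNIV. \<bar>A * y + \<psi> x $ j\<bar> * t $ j) / A
       + C1 * ((\<Sum>j\<in>UNIV. norm (x $ j) * t $ j) / A)
       + C2 * ((\<Sum>j\<in>UNIV. norm (x $ j) * sqrt (s $ j * t $ j)) / A)
       + C3 * ((\<Sum>j\<in>UNIV. (z $ j - norm (x $ j)) * s $ j) / A)"
    by (simp add: Phi_def sum.distrib sum_distrib_left add_divide_distrib mult.assoc)
  also have "\<dots> \<le> (\<bar>y\<bar> * T + (\<Sum>j\<in>UNIV. \<bar>\<psi> x $ j\<bar> * t $ j))
       + C1 * (norm (avg x) * T - (\<Sum>j\<in>UNIV. F j * t $ j))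
       + C2 * (norm (avg x) * r - gap A x * r)
       + C3 * ((avg z - norm (avg x)) * S - defect x * S)"
    using P2 C0 by (intro add_mono mult_left_mono P1 P3 P4) auto
  also have "\<dots> \<le> Phi C1 C2 C3 (avg x, y, avg z, T, S)"
    using fin by (simp add: Phi_def r_def[symmetric] algebra_simps)
  finally show ?thesis by (simp add: T_def)
qed

text \<open>The operator is given on \<open>W\<close> only; a linear extension makes \<open>x \<mapsto> \<phi> (centered x)\<close> agree on the
  relevant tuples with a continuous map of the whole space.\<close>
lemma linear_operator_extension:
  assumes W: "subspace W" and \<phi>: "linear_operator W \<phi>"
  obtains g where "linear g" "\<And>w. w \<in> W \<Longrightarrow> g w = \<phi> w"
proof -
  obtain B where B: "B \<subseteq> W" "independent B" "W \<subseteq> span B"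
    by (rule basis_exists[of W])
  obtain g where g: "linear g" "\<And>w. w \<in> B \<Longrightarrow> g w = \<phi> w"
    using linear_independent_extend[OF B(2), of \<phi>] by blast
  have add: "\<And>u w. u \<in> W \<Longrightarrow> w \<in> W \<Longrightarrow> \<phi> (u + w) = \<phi> u + \<phi> w"
    and sc: "\<And>c w. w \<in> W \<Longrightarrow> \<phi> (c *\<^sub>R w) = c *\<^sub>R \<phi> w"
    using \<phi> by (auto simp: linear_operator_def)
  have "w \<in> W \<and> g w = \<phi> w" if "w \<in> span B" for w
    using that
  proof (induction rule: span_induct_alt)
    case base
    then show ?case using sc[of 0 0] subspace_0[OF W] by (simp add: linear_0[OF g(1)])
  next
    case (step c x y)
    then have "x \<in> W" "y \<in> W" using B(1) by auto
    then show ?case using step W g(2)[of x]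
      by (simp add: linear_add[OF g(1)] linear_cmul[OF g(1)] add sc subspace_add subspace_scale)
  qed
  then show ?thesis using g(1) B(3) that by blast
qed

theorem theorem5p2:
  fixes W :: "(real ^ 'l ^ 'm) set"
    and \<phi> :: "real ^ 'l ^ 'm \<Rightarrow> real ^ 'm"
  assumes "CARD('m) \<ge> 2"
    and "subspace W" and "W \<subseteq> V_tensor"
    and "geometric W" and "nonlocal W"
    and "0 < order_alpha W" and "order_alpha W < 1"
    and "linear_operator W \<phi>" and "canceling W \<phi>"
  shows "\<forall>\<^sub>F C1 in at_top. \<forall>\<^sub>F C2 in at_top. \<forall>\<^sub>F C3 in at_top.
           supersolution W \<phi> (Phi C1 C2 C3)"
proof -
  let ?m = "real CARD('m)"
  define A where "A = ?m powr order_alpha W"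
  have A: "A \<ge> 1" using assms(1,6) by (simp add: A_def ge_one_powr_ge_zero)
  obtain g where g: "linear g" "\<And>w. w \<in> W \<Longrightarrow> g w = \<phi> w"
    using linear_operator_extension[OF assms(2,8)] by blast
  define \<psi> where "\<psi> = g \<circ> centered"
  have \<psi>: "linear \<psi>" unfolding \<psi>_def by (intro linear_compose linear_centered g(1))
  have \<psi>\<phi>: "\<psi> x = \<phi> (centered x)" if "centered x \<in> W" for x
    using that g(2) by (simp add: \<psi>_def)
  have sub: "subspace {x. centered x \<in> W}"
    using linear_subspace_vimage[OF linear_centered assms(2)] by (simp add: vimage_def)
  obtain M where M: "M > 0" "\<And>x. centered x \<in> W \<Longrightarrow> core_estimate A \<psi> M x"
    using core_estimate_uniform[OF sub \<psi>, of A]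
      core_estimate_local[OF assms(1,2,4,5,6,9) \<psi> \<psi>\<phi>] by (auto simp: A_def)
  have super: "supersolution W \<phi> (Phi C1 C2 C3)"
    if C: "C1 \<ge> M" "C2 \<ge> C1 * M" "C3 \<ge> C2 * M" for C1 C2 C3
  proof -
    have "main_inequality W \<phi> (Phi C1 C2 C3)"
      unfolding main_inequality_def
    proof (clarify)
      fix x y z t s
      assume cfg: "(x, y, z, t, s) \<in> config_space W"
      then have x: "centered x \<in> W" and om: "norm (x $ j) \<le> z $ j" "0 \<le> t $ j" "t $ j \<le> s $ j" for j
        by (auto simp: config_space_def Omega_def)
      define S where "S = smax (order_alpha W) t s"
      have "s $ j \<le> S * A / ?m" for j
      proof -
        have "?m powr (1 - order_alpha W) * s $ j \<le> ?m powr (1 - order_alpha W) * (MAX j. s $ j)"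
          by (intro mult_left_mono Max_ge) auto
        also have "\<dots> \<le> S" by (simp add: S_def smax_def)
        finally show ?thesis using A
          by (simp add: A_def powr_diff pos_le_divide_eq pos_divide_le_eq mult.commute)
      qed
      moreover have "tot t \<le> S" by (simp add: S_def smax_def)
      ultimately have "(\<Sum>j\<in>UNIV. Phi C1 C2 C3 (x $ j, A * y + \<psi> x $ j, z $ j, t $ j, s $ j)) / A
        \<le> Phi C1 C2 C3 (avg x, y, avg z, tot t, S)"
        by (intro main_inequality_if_core_estimate[OF A M(1) M(2)[OF x] C om])
      then show "?m powr (- order_alpha W) *
          (\<Sum>j\<in>UNIV. Phi C1 C2 C3 (x $ j, ?m powr order_alpha W * y + \<phi> (centered x) $ j, z $ j, t $ j, s $ j))
        \<le> Phi C1 C2 C3 (avg x, y, avg z, tot t, smax (order_alpha W) t s)"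
        unfolding \<psi>\<phi>[OF x] A_def S_def by (simp add: powr_minus divide_inverse mult.commute)
    qed
    moreover have "boundary_inequality (Phi C1 C2 C3 :: (real ^ 'l) \<times> _ \<Rightarrow> _)"
    proof -
      have "0 \<le> C1" "0 \<le> C2" using C M(1)
        by (auto intro: order_trans[OF _ C(2)] order_trans[OF _ C(1)] mult_nonneg_nonneg)
      then show ?thesis by (auto simp: boundary_inequality_def Phi_def)
    qed
    ultimately show ?thesis by (simp add: supersolution_def)
  qed
  show ?thesis
    using eventually_ge_at_top[of M]
  proof eventually_elim
    case (elim C1)
    show ?case using eventually_ge_at_top[of "C1 * M"]
    proof eventually_elim
      case (elim C2)
      show ?case using eventually_ge_at_top[of "C2 * M"]
        by eventually_elim (use super elim \<open>M \<le> C1\<close> in auto)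
    qed
  qed
qed

end
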